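(* Let $1<\alpha\le 2$, $\eta\in(0,1)$, $\beta>0$, let $f:[0,1]\times\mathbb{R}\to[0,\infty)$ be continuous, and let $H_1,H_2:C[0,1]\to[0,\infty)$ be compact functionals. Assume $\beta=\max\{\beta_K,\beta_\gamma\}$ and fix $b\in[\eta,1)$. Let $\rho>0$ and assume that: (1) there exists $\underline{\delta}_\rho\in C([0,b],\mathbb{R}^+)$ such that $f(t,u)\ge\underline{\delta}_\rho(t)$ for all $(t,u)\in[0,b]\times[\sigma_2\rho,\rho]$; (2) there exist $\eta_{1,\rho},\eta_{2,\rho}\ge 0$ such that $H_1[u]\ge\eta_{1,\rho}$ and $H_2[u]\ge\eta_{2,\rho}$ for every $u\in P_{\sigma_2}\cap\partial\Omega_\rho$; (3) the inequality $$\gamma(0)\,\eta_{1,\rho}+\eta_{2,\rho}+\int_0^bK(0,s)\,\underline{\delta}_\rho(s)\,ds>0$$ holds. Then there exist $\lambda_\rho>0$ and $u_\rho\in P_{\sigma_2}\cap\partial\Omega_\rho$ such that the couple $(\lambda_\rho,u_\rho)$ solves (in the mild sense) the boundary value problem $$\begin{cases}{}^{C}D^{\alpha}u(t)+\lambda f(t,u(t))=0,\quad t\in(0,1),\\ u'(0)+\lambda H_1[u]=0,\\ \beta\,{}^{C}D^{\alpha-1}u(1)+u(\eta)=\lambda H_2[u],\end{cases}$$ $u_\rho(t)\ge 0$ for every $t\in[0,1]$, and $\sigma_2\rho\le u_\rho(t)\le\rho$ for every $t\in[0,b]$.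
   Context: $C[0,1]$ carries the supremum norm $\|\cdot\|_\infty$; $\Omega_\rho=\{u\in C[0,1]:\|u\|_\infty<\rho\}$, with boundary $\partial\Omega_\rho=\{u:\|u\|_\infty=\rho\}$. $\mathbb{R}^+=[0,\infty)$. $\Gamma$ is the Gamma function and ${}^{C}D^{\alpha}$ the Caputo fractional derivative of order $\alpha$. "Compact" means continuous and mapping bounded sets to relatively compact sets; $H_1,H_2$ need not be linear. For $t,s\in[0,1]$ put $$\gamma(t)=\frac{\beta}{\Gamma(3-\alpha)}+\eta-t,\qquad K(t,s)=\beta+\frac{(\eta-s)^{\alpha-1}}{\Gamma(\alpha)}\chi_{[0,\eta]}(s)-\frac{(t-s)^{\alpha-1}}{\Gamma(\alpha)}\chi_{[0,t]}(s),$$ where $\chi_A$ is the characteristic function of $A$ (the corresponding term is $0$ when $s\notin A$), and for $u\in C[0,1]$ $$T(u)(t)=H_1[u]\gamma(t)+H_2[u]+\int_0^1K(t,s)f(s,u(s))\,ds .$$ Mild solution: the couple $(\lambda,u)$ with $u\in C[0,1]$ solves the boundary value problem in the mild sense if, by definition, $u(t)=\lambda\,T(u)(t)$ for all $t\in[0,1]$. Thresholds: $\beta_K=\frac{(1-\eta)^{\alpha-1}}{\Gamma(\alpha)}$ and $\beta_\gamma=(1-\eta)\Gamma(3-\alpha)$. Constants and cone (for the fixed $b\in[\eta,1)$): $$c_{2,K}=\frac{\beta\Gamma(\alpha)-(b-\eta)^{\alpha-1}}{\beta\Gamma(\alpha)+\eta^{\alpha-1}},\qquad \sigma_{2,\gamma}=\frac{\beta+(\eta-b)\Gamma(3-\alpha)}{\beta+\eta\,\Gamma(3-\alpha)},\qquad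 \sigma_2=\min\{\sigma_{2,\gamma},1,c_{2,K}\},$$ $$P_{\sigma_2}=\Bigl\{u\in C[0,1]:\ u\ge 0 \text{ on }[0,1],\ \min_{t\in[0,b]}u(t)\ge\sigma_2\|u\|_\infty\Bigr\}.$$ *)

theory Defs
  imports "HOL-Analysis.Analysis"
begin

typedef unit_interval = "{0..1::real}"
  morphisms real_of_ui ui_of_real
  by auto

instantiation unit_interval :: metric_space
begin

definition dist_unit_interval :: "unit_interval \<Rightarrow> unit_interval \<Rightarrow> real"
  where "dist_unit_interval x y = dist (real_of_ui x) (real_of_ui y)"

definition uniformity_unit_interval :: "(unit_interval \<times> unit_interval) filter"
  where "uniformity_unit_interval = (INF e\<in>{0 <..}. principal {(x, y). dist x y < e})"

definition open_unit_interval :: "unit_interval set \<Rightarrow> bool"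
  where "open_unit_interval S = (\<forall>x\<in>S. \<forall>\<^sub>F (x', y) in uniformity. x' = x \<longrightarrow> y \<in> S)"

instance
proof
  fix x y z :: unit_interval
  show "dist x y = 0 \<longleftrightarrow> x = y"
    by (simp add: dist_unit_interval_def real_of_ui_inject)
  show "dist x y \<le> dist x z + dist y z"
    unfolding dist_unit_interval_def by (rule dist_triangle2)
qed (rule open_unit_interval_def uniformity_unit_interval_def)+

end

(* The Banach space C[0,1] with the supremum norm: every continuous function on the
   compact space unit_interval is bounded, so nothing is lost by using the library type of
   bounded continuous functions (see ev_ex and norm_C01 below). *)
type_synonym C01 = "unit_interval \<Rightarrow>\<^sub>C real"

(* The value u(t) at a real number t; only meaningful for t in [0,1]. *)
definition ev :: "C01 \<Rightarrow> real \<Rightarrow> real"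
  where "ev u t = apply_bcontfun u (ui_of_real t)"

lemma continuous_on_ui_of_real: "continuous_on {0..1} ui_of_real"
  unfolding continuous_on_iff dist_unit_interval_def
  by (auto simp: ui_of_real_inverse)

lemma continuous_on_real_of_ui: "continuous_on UNIV real_of_ui"
  unfolding continuous_on_iff dist_unit_interval_def
  by auto

lemma continuous_on_ev: "continuous_on {0..1} (ev u)"
proof -
  have "continuous_on {0..1} (apply_bcontfun u \<circ> ui_of_real)"
    by (intro continuous_on_compose continuous_on_ui_of_real continuous_on_apply_bcontfun)
  then show ?thesis
    by (simp add: ev_def[abs_def] comp_def)
qed

lemma ev_ex:
  assumes "continuous_on {0..1} g"
  shows "\<exists>u::C01. \<forall>t\<in>{0..1}. ev u t = g t"
proof -
  have r: "range real_of_ui = {0..1}"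
    using type_definition.Rep_range[OF type_definition_unit_interval] .
  have c: "continuous_on UNIV (\<lambda>x. g (real_of_ui x))"
    using continuous_on_compose2[OF assms continuous_on_real_of_ui] r by auto
  have "bounded (g ` {0..1})"
    using compact_continuous_image[OF assms] compact_imp_bounded by blast
  then have "bounded (range (\<lambda>x. g (real_of_ui x)))"
    using r by (metis image_image)
  with c have "(\<lambda>x. g (real_of_ui x)) \<in> bcontfun"
    by (simp add: bcontfun_def)
  then show ?thesis
    by (intro exI[of _ "Bcontfun (\<lambda>x. g (real_of_ui x))"])
      (simp add: ev_def Bcontfun_inverse ui_of_real_inverse)
qed

lemma norm_C01: "norm (u::C01) = (SUP t\<in>{0..1}. \<bar>ev u t\<bar>)"
proof -
  have "ui_of_real ` {0..1} = UNIV"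
    using type_definition.Abs_image[OF type_definition_unit_interval] .
  then have "(\<lambda>t. \<bar>ev u t\<bar>) ` {0..1} = range (\<lambda>x. \<bar>apply_bcontfun u x\<bar>)"
    by (metis (no_types, lifting) ev_def image_cong image_image)
  moreover have "norm u = (SUP x. \<bar>apply_bcontfun u x\<bar>)"
    by (simp add: norm_bcontfun_def dist_bcontfun_def dist_norm zero_bcontfun.rep_eq)
  ultimately show ?thesis
    by simp
qed

(* Compact, not necessarily linear, maps. *)
definition compact_map :: "('a::metric_space \<Rightarrow> 'b::metric_space) \<Rightarrow> bool"
  where "compact_map H \<longleftrightarrow>
    continuous_on UNIV H \<and> (\<forall>B. bounded B \<longrightarrow> compact (closure (H ` B)))"

definition gam :: "real \<Rightarrow> real \<Rightarrow> real \<Rightarrow> real \<Rightarrow> real"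
  where "gam \<alpha> \<beta> \<eta> t = \<beta> / Gamma (3 - \<alpha>) + \<eta> - t"

definition kern :: "real \<Rightarrow> real \<Rightarrow> real \<Rightarrow> real \<Rightarrow> real \<Rightarrow> real"
  where "kern \<alpha> \<beta> \<eta> t s =
    \<beta> + (\<eta> - s) powr (\<alpha> - 1) / Gamma \<alpha> * indicator {0..\<eta>} s
      - (t - s) powr (\<alpha> - 1) / Gamma \<alpha> * indicator {0..t} s"

definition bvp_op ::
    "real \<Rightarrow> real \<Rightarrow> real \<Rightarrow> (real \<Rightarrow> real \<Rightarrow> real) \<Rightarrow> (C01 \<Rightarrow> real) \<Rightarrow> (C01 \<Rightarrow> real) \<Rightarrow> C01 \<Rightarrow> real \<Rightarrow> real"
  where "bvp_op \<alpha> \<beta> \<eta> f H1 H2 u t =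
    H1 u * gam \<alpha> \<beta> \<eta> t + H2 u + integral {0..1} (\<lambda>s. kern \<alpha> \<beta> \<eta> t s * f s (ev u s))"

(* (lam, u) solves, in the mild sense, the problem
     D^alpha u(t) + lam f(t, u(t)) = 0  for t in (0,1),
     u'(0) + lam H1[u] = 0,
     beta D^(alpha-1) u(1) + u(eta) = lam H2[u],
   where D is the Caputo derivative.  The mild sense is by definition the fixed-point equation,
   so no fractional derivative occurs in it. *)
definition mild_solution ::
    "real \<Rightarrow> real \<Rightarrow> real \<Rightarrow> (real \<Rightarrow> real \<Rightarrow> real) \<Rightarrow> (C01 \<Rightarrow> real) \<Rightarrow> (C01 \<Rightarrow> real) \<Rightarrow> real \<Rightarrow> C01 \<Rightarrow> bool"
  where "mild_solution \<alpha> \<beta> \<eta> f H1 H2 lam u \<longleftrightarrow>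
    (\<forall>t\<in>{0..1}. ev u t = lam * bvp_op \<alpha> \<beta> \<eta> f H1 H2 u t)"

definition beta_K :: "real \<Rightarrow> real \<Rightarrow> real"
  where "beta_K \<alpha> \<eta> = (1 - \<eta>) powr (\<alpha> - 1) / Gamma \<alpha>"

definition beta_gam :: "real \<Rightarrow> real \<Rightarrow> real"
  where "beta_gam \<alpha> \<eta> = (1 - \<eta>) * Gamma (3 - \<alpha>)"

definition c2K :: "real \<Rightarrow> real \<Rightarrow> real \<Rightarrow> real \<Rightarrow> real"
  where "c2K \<alpha> \<beta> \<eta> b =
    (\<beta> * Gamma \<alpha> - (b - \<eta>) powr (\<alpha> - 1)) / (\<beta> * Gamma \<alpha> + \<eta> powr (\<alpha> - 1))"

definition sigma2_gam :: "real \<Rightarrow> real \<Rightarrow> real \<Rightarrow> real \<Rightarrow> real"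
  where "sigma2_gam \<alpha> \<beta> \<eta> b =
    (\<beta> + (\<eta> - b) * Gamma (3 - \<alpha>)) / (\<beta> + \<eta> * Gamma (3 - \<alpha>))"

definition sigma2 :: "real \<Rightarrow> real \<Rightarrow> real \<Rightarrow> real \<Rightarrow> real"
  where "sigma2 \<alpha> \<beta> \<eta> b = Min {sigma2_gam \<alpha> \<beta> \<eta> b, 1, c2K \<alpha> \<beta> \<eta> b}"

(* The infimum is an attained minimum, since ev u is continuous on [0,b] for 0 <= b <= 1. *)
definition order_cone :: "real \<Rightarrow> real \<Rightarrow> C01 set"
  where "order_cone b \<sigma> =
    {u. (\<forall>t\<in>{0..1}. 0 \<le> ev u t) \<and> (INF t\<in>{0..b}. ev u t) \<ge> \<sigma> * norm u}"

end

theory Submission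
  imports Defs "HOL-Complex_Analysis.Great_Picard"
begin

text \<open>
  The theorem is an instance of the Birkhoff--Kellogg principle in a cone: if \<open>T\<close> maps the part of a
  sphere that lies in a cone into a compact subset of the cone, and \<open>T\<close> stays away from \<open>0\<close> there,
  then \<open>T\<close> has on it an eigenvector with a positive eigenvalue.

  The spherical part of the cone is not convex, so Schauder's theorem does not apply to the
  normalised map \<open>N T\<close>, \<open>N y = (\<rho> / norm y) y\<close>, on it. But the spherical part is a retract of the
  convex set \<open>P \<inter> cball 0 \<rho>\<close>: for nonnegative functions, adding a constant \<open>c \<ge> 0\<close> raises the
  supremum norm by exactly \<open>c\<close>, so \<open>r v = v + (\<rho> - norm v) 1\<close> is a retraction. A fixed point of
  \<open>N T r\<close> is on the sphere, where \<open>r\<close> is the identity, and is therefore an eigenvector of \<open>T\<close>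
  (\<open>birkhoff_kellogg_cone\<close>). Schauder's theorem (\<open>schauder\<close>) comes from Brouwer's theorem on the
  cubes \<open>[0,1]^n\<close> (\<open>brouwer_cube\<close>), and this from Kuhn's combinatorial lemma.

  What the boundary value problem contributes is that \<open>T\<close> satisfies the hypotheses. The kernel
  estimates rest on one fact about \<open>x \<mapsto> (max 0 x) powr a\<close> with \<open>0 < a \<le> 1\<close>, that it is
  subadditive (\<open>pos_powr_diff_le\<close>). It bounds \<open>K(t,s)\<close> below by its value at \<open>s = \<eta>\<close>, namely
  \<open>\<beta> - (t - \<eta>) powr (\<alpha> - 1) / Gamma \<alpha>\<close> for \<open>t \<ge> \<eta>\<close>, which gives positivity for \<open>\<beta> \<ge> beta_K\<close> and
  the cone inequality (\<open>kern_cone\<close>). It also makes \<open>K\<close> Hoelder continuous in \<open>t\<close>, uniformly in \<open>s\<close>,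
  so that \<open>T\<close> maps balls into Hoelder balls, which are compact by Arzela--Ascoli. Finally, the
  lower bounds on \<open>f\<close>, \<open>H1\<close> and \<open>H2\<close> bound \<open>T(u)(0)\<close> below by the number that
  is assumed to be positive (\<open>Op_0_ge\<close>), and so keep \<open>T\<close> away from \<open>0\<close>.
\<close>

section \<open>Brouwer's fixed point theorem on cubes\<close>

text \<open>
  The dimension is a term and not a type, because the proof of Schauder's theorem uses cubes of
  dimensions that depend on the accuracy. Fixing the remaining coordinates makes the cube a compact
  set of total functions.
\<close>

definition cube :: "nat \<Rightarrow> (nat \<Rightarrow> real) set"
  where "cube n = {x. (\<forall>i<n. 0 \<le> x i \<and> x i \<le> 1) \<and> (\<forall>i\<ge>n. x i = 0)}"

lemma compact_cube: "compact (cube n)"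
proof -
  have "cube n = PiE UNIV (\<lambda>i. if i < n then {0..1} else {0})"
    by (auto simp: cube_def PiE_def Pi_def not_less split: if_splits)
  moreover have "compactin (product_topology (\<lambda>i::nat. euclideanreal) UNIV)
      (PiE UNIV (\<lambda>i. if i < n then {0..1} else {0}))"
    by (subst compactin_PiE) auto
  ultimately show ?thesis
    by (simp add: euclidean_product_topology)
qed

lemma tendsto_coordinatewise:
  fixes X :: "nat \<Rightarrow> nat \<Rightarrow> real"
  shows "X \<longlonglongrightarrow> x \<longleftrightarrow> (\<forall>i. (\<lambda>p. X p i) \<longlonglongrightarrow> x i)"
proof -
  have "X \<longlonglongrightarrow> x \<longleftrightarrow> limitin (product_topology (\<lambda>i::nat. euclideanreal) UNIV) X x sequentially"
    by (simp add: euclidean_product_topology)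
  then show ?thesis
    by (simp add: limitin_componentwise)
qed

text \<open>
  Kuhn's lemma for the grid of mesh \<open>1/p\<close>: label a vertex in direction \<open>i\<close> by whether \<open>G\<close> moves it
  up or down. Some grid cell then has, for each \<open>i\<close>, a vertex \<open>u i\<close> that is moved up and a vertex
  \<open>v i\<close> that is moved down in direction \<open>i\<close>.
\<close>

lemma cube_grid_near_fixpoint:
  fixes G :: "(nat \<Rightarrow> real) \<Rightarrow> nat \<Rightarrow> real"
  assumes G: "\<And>x. x \<in> cube n \<Longrightarrow> G x \<in> cube n" and p: "0 < p"
  obtains q u v where "q \<in> cube n"
    "\<And>i. i < n \<Longrightarrow> u i \<in> cube n \<and> v i \<in> cube n"
    "\<And>i j. i < n \<Longrightarrow> \<bar>u i j - q j\<bar> \<le> 1 / real p \<and> \<bar>v i j - q j\<bar> \<le> 1 / real p"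
    "\<And>i. i < n \<Longrightarrow> u i i \<le> G (u i) i \<and> G (v i) i \<le> v i i"
proof -
  define pt :: "(nat \<Rightarrow> nat) \<Rightarrow> nat \<Rightarrow> real"
    where "pt z = (\<lambda>i. if i < n then real (z i) / real p else 0)" for z
  \<comment> \<open>The labels on the faces are forced to the values that Kuhn's lemma requires; there they still
    tell the truth, since \<open>G\<close> cannot leave the cube.\<close>
  define label :: "(nat \<Rightarrow> nat) \<Rightarrow> nat \<Rightarrow> nat"
    where "label z i = (if z i = p \<or> (z i \<noteq> 0 \<and> G (pt z) i < pt z i) then 1 else 0)" for z i
  have pt_cube: "pt z \<in> cube n" if "\<forall>i<n. z i \<le> p" for z
    using that p by (auto simp: pt_def cube_def)
  have label0: "pt z i \<le> G (pt z) i" if "\<forall>i<n. z i \<le> p" "i < n" "label z i = 0" for z i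
  proof (cases "z i = 0")
    case True
    then show ?thesis using G[OF pt_cube[OF that(1)]] that(2) by (simp add: pt_def cube_def)
  next
    case False
    then show ?thesis using that(3) by (auto simp: label_def split: if_splits)
  qed
  have label1: "G (pt z) i \<le> pt z i" if "\<forall>i<n. z i \<le> p" "i < n" "label z i \<noteq> 0" for z i
  proof (cases "z i = p")
    case True
    then show ?thesis using G[OF pt_cube[OF that(1)]] that(2) p by (simp add: pt_def cube_def)
  next
    case False
    then show ?thesis using that(3) by (auto simp: label_def split: if_splits)
  qed
  obtain q where q: "\<forall>i<n. q i < p"
    and rs: "\<forall>i<n. \<exists>r s. (\<forall>j<n. q j \<le> r j \<and> r j \<le> q j + 1)
      \<and> (\<forall>j<n. q j \<le> s j \<and> s j \<le> q j + 1) \<and> label r i \<noteq> label s i"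
    proof (rule kuhn_lemma[OF p, of n label])
    show "\<forall>x. (\<forall>i<n. x i \<le> p) \<longrightarrow> (\<forall>i<n. label x i = 0 \<or> label x i = 1)"
      by (simp add: label_def)
    show "\<forall>x. (\<forall>i<n. x i \<le> p) \<longrightarrow> (\<forall>i<n. x i = 0 \<longrightarrow> label x i = 0)"
      using p by (simp add: label_def)
    show "\<forall>x. (\<forall>i<n. x i \<le> p) \<longrightarrow> (\<forall>i<n. x i = p \<longrightarrow> label x i = 1)"
      by (simp add: label_def)
  qed
  have near: "(\<forall>j<n. r j \<le> p) \<and> (\<forall>j. \<bar>pt r j - pt q j\<bar> \<le> 1 / real p)"
    if "\<forall>j<n. q j \<le> r j \<and> r j \<le> q j + 1" for r
  proof (intro conjI allI impI)
    fix j assume "j < n"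
    then show "r j \<le> p" using that q by fastforce
  next
    fix j
    show "\<bar>pt r j - pt q j\<bar> \<le> 1 / real p"
    proof (cases "j < n")
      case True
      then have "\<bar>real (r j) - real (q j)\<bar> \<le> 1" using that by force
      then have "\<bar>real (r j) - real (q j)\<bar> / real p \<le> 1 / real p"
        by (intro divide_right_mono) auto
      then show ?thesis using True by (simp add: pt_def diff_divide_distrib[symmetric])
    qed (simp add: pt_def)
  qed
  have "\<exists>u v. u \<in> cube n \<and> v \<in> cube n
      \<and> (\<forall>j. \<bar>u j - pt q j\<bar> \<le> 1 / real p \<and> \<bar>v j - pt q j\<bar> \<le> 1 / real p)
      \<and> u i \<le> G u i \<and> G v i \<le> v i" if i: "i < n" for i
  proof -
    obtain r s where r: "\<forall>j<n. q j \<le> r j \<and> r j \<le> q j + 1"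
      and s: "\<forall>j<n. q j \<le> s j \<and> s j \<le> q j + 1" and ne: "label r i \<noteq> label s i"
      using rs i by blast
    have *: ?thesis if r: "\<forall>j<n. q j \<le> r j \<and> r j \<le> q j + 1"
      and s: "\<forall>j<n. q j \<le> s j \<and> s j \<le> q j + 1" and "label r i = 0" "label s i \<noteq> 0" for r s
      using near[OF r] near[OF s] that(3,4) i
      by (intro exI[of _ "pt r"] exI[of _ "pt s"]) (simp add: pt_cube label0 label1)
    show ?thesis
    proof (cases "label r i = 0")
      case True
      with ne show ?thesis using *[OF r s] by simp
    next
      case False
      then have "label s i = 0" using ne by (auto simp: label_def split: if_splits)
      with False show ?thesis using *[OF s r] by simp
    qed
  qed
  then obtain u v where "\<And>i. i < n \<Longrightarrow> u i \<in> cube n \<and> v i \<in> cube n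
      \<and> (\<forall>j. \<bar>u i j - pt q j\<bar> \<le> 1 / real p \<and> \<bar>v i j - pt q j\<bar> \<le> 1 / real p)
      \<and> u i i \<le> G (u i) i \<and> G (v i) i \<le> v i i"
    by metis
  moreover have "pt q \<in> cube n" using q by (intro pt_cube) (auto intro: less_imp_le)
  ultimately show thesis by (intro that[of "pt q" u v]) auto
qed

text \<open>
  Cells of mesh tending to \<open>0\<close> as above accumulate at a point \<open>x\<close>. For each \<open>i\<close> the vertices moved up
  and those moved down in direction \<open>i\<close> both converge to \<open>x\<close>, so continuity leaves only
  \<open>G x i = x i\<close>.
\<close>

theorem brouwer_cube:
  fixes G :: "(nat \<Rightarrow> real) \<Rightarrow> nat \<Rightarrow> real"
  assumes cont: "continuous_on (cube n) G" and G: "G \<in> cube n \<rightarrow> cube n"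
  obtains x where "x \<in> cube n" "G x = x"
proof -
  have "\<exists>q u v. q \<in> cube n \<and> (\<forall>i<n. u i \<in> cube n \<and> v i \<in> cube n
      \<and> (\<forall>j. \<bar>u i j - q j\<bar> \<le> 1 / real (Suc p) \<and> \<bar>v i j - q j\<bar> \<le> 1 / real (Suc p))
      \<and> u i i \<le> G (u i) i \<and> G (v i) i \<le> v i i)" for p
  proof -
    obtain q u v where "q \<in> cube n"
      "\<And>i. i < n \<Longrightarrow> u i \<in> cube n \<and> v i \<in> cube n"
      "\<And>i j. i < n \<Longrightarrow> \<bar>u i j - q j\<bar> \<le> 1 / real (Suc p) \<and> \<bar>v i j - q j\<bar> \<le> 1 / real (Suc p)"
      "\<And>i. i < n \<Longrightarrow> u i i \<le> G (u i) i \<and> G (v i) i \<le> v i i"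
      using cube_grid_near_fixpoint[of n G "Suc p"] G by blast
    then show ?thesis
      by (intro exI[of _ q] exI[of _ u] exI[of _ v] conjI allI impI) auto
  qed
  then obtain q u v where q: "\<And>p. q p \<in> cube n"
    and uv: "\<And>p i. i < n \<Longrightarrow> u p i \<in> cube n \<and> v p i \<in> cube n
      \<and> (\<forall>j. \<bar>u p i j - q p j\<bar> \<le> 1 / real (Suc p) \<and> \<bar>v p i j - q p j\<bar> \<le> 1 / real (Suc p))
      \<and> u p i i \<le> G (u p i) i \<and> G (v p i) i \<le> v p i i"
    by metis
  obtain x k where x: "x \<in> cube n" and k: "strict_mono (k :: nat \<Rightarrow> nat)" and lim: "(q \<circ> k) \<longlonglongrightarrow> x"
    using compact_imp_seq_compact[OF compact_cube[of n]] q unfolding seq_compact_def by meson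
  have small: "(\<lambda>m. 1 / real (Suc (k m))) \<longlonglongrightarrow> 0"
    using LIMSEQ_subseq_LIMSEQ[OF LIMSEQ_Suc[OF lim_1_over_n] k] by (simp add: comp_def)
  have near: "(\<lambda>m. w (k m)) \<longlonglongrightarrow> x"
    if "\<And>p j. \<bar>w p j - q p j\<bar> \<le> 1 / real (Suc p)" for w
    unfolding tendsto_coordinatewise
  proof
    fix j
    have "(\<lambda>m. w (k m) j - q (k m) j) \<longlonglongrightarrow> 0"
      by (rule tendsto_rabs_zero_cancel, rule tendsto_sandwich[OF _ _ tendsto_const small])
        (use that in auto)
    moreover have "(\<lambda>m. q (k m) j) \<longlonglongrightarrow> x j"
      using lim by (simp add: tendsto_coordinatewise comp_def)
    ultimately show "(\<lambda>m. w (k m) j) \<longlonglongrightarrow> x j"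
      using tendsto_add by fastforce
  qed
  have G_lim: "(\<lambda>m. G (w m) i) \<longlonglongrightarrow> G x i"
    if "w \<longlonglongrightarrow> x" "\<And>m. w m \<in> cube n" for w i
    using continuous_on_tendsto_compose[OF cont that(1) x] that(2)
    by (simp add: tendsto_coordinatewise)
  have "G x i = x i" for i
  proof (cases "i < n")
    case True
    have u: "(\<lambda>m. u (k m) i) \<longlonglongrightarrow> x" and v: "(\<lambda>m. v (k m) i) \<longlonglongrightarrow> x"
      using uv[OF True] by (auto intro!: near[of "\<lambda>p. u p i"] near[of "\<lambda>p. v p i"])
    have u_lim: "(\<lambda>m. u (k m) i i) \<longlonglongrightarrow> x i" and v_lim: "(\<lambda>m. v (k m) i i) \<longlonglongrightarrow> x i"
      using u v by (simp_all add: tendsto_coordinatewise)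
    have "u p i \<in> cube n" "v p i \<in> cube n" "u p i i \<le> G (u p i) i" "G (v p i) i \<le> v p i i" for p
      using uv[OF True] by blast+
    note uv_p = this
    have "x i \<le> G x i"
      using LIMSEQ_le[OF u_lim G_lim[OF u uv_p(1)]] uv_p(3) by blast
    moreover have "G x i \<le> x i"
      using LIMSEQ_le[OF G_lim[OF v uv_p(2)] v_lim] uv_p(4) by blast
    ultimately show ?thesis by simp
  next
    case False
    moreover have "G x \<in> cube n" using G x by (rule funcset_mem)
    ultimately show ?thesis using x by (simp add: cube_def)
  qed
  then have "G x = x" by (rule ext)
  with x show thesis by (rule that)
qed

section \<open>Schauder's fixed point theorem\<close>

text \<open>
  The classical Schauder projection, with the parameters reversed so that Brouwer's theorem is
  used on a cube: a point \<open>c\<close> of the cube gives the convex combination \<open>comb c\<close> of a finite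
  \<open>e\<close>-net of \<open>K\<close>, and \<open>F (comb c)\<close> gives back its Schauder weights with respect to the net. A fixed
  point \<open>c\<close> of this loop is a weight vector, and \<open>comb c\<close> averages net points within distance \<open>e\<close>
  of \<open>F (comb c)\<close>.
\<close>

lemma schauder_approx:
  fixes F :: "'a::real_normed_vector \<Rightarrow> 'a"
  assumes D: "convex D" "D \<noteq> {}" and cont: "continuous_on D F"
    and K: "compact K" "K \<subseteq> D" "F \<in> D \<rightarrow> K" and e: "0 < e"
  obtains x where "x \<in> D" "norm (x - F x) \<le> e"
proof -
  obtain Y where Y: "finite Y" "Y \<subseteq> K" "K \<subseteq> (\<Union>y\<in>Y. ball y e)"
    using compactE_image[OF K(1), of K "\<lambda>y. ball y e"] e
    by (metis (no_types, lifting) UN_I centre_in_ball open_ball subsetI)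
  obtain y n where y: "Y = y ` {..<n::nat}"
    using finite_imp_nat_seg_image_inj_on[OF Y(1)] by (metis lessThan_def)
  have yD: "y i \<in> D" if "i < n" for i using that y Y(2) K(2) by auto
  have "K \<noteq> {}" using D(2) K(3) by auto
  then have n: "0 < n" using Y(3) y by (cases n) auto

  \<comment> \<open>\<open>t\<close> retracts the cube onto the standard simplex: a deficit of the coordinate sum \<open>S c\<close> is
    spread evenly, an excess is divided out.\<close>
  define S where "S c = (\<Sum>i<n. c i)" for c :: "nat \<Rightarrow> real"
  define t where "t c i = (c i + max 0 (1 - S c) / real n) / max 1 (S c)" for c i
  define comb where "comb c = (\<Sum>i<n. t c i *\<^sub>R y i)" for c
  have t_sum: "(\<Sum>i<n. t c i) = 1" for c
  proof -
    have "(\<Sum>i<n. t c i) = (S c + max 0 (1 - S c)) / max 1 (S c)"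
      using n by (simp add: t_def S_def sum.distrib flip: sum_divide_distrib)
    also have "S c + max 0 (1 - S c) = max 1 (S c)" by (simp add: max_def)
    finally show ?thesis by simp
  qed
  have t_nonneg: "0 \<le> t c i" if "c \<in> cube n" "i < n" for c i
    using that by (auto simp: t_def cube_def intro!: divide_nonneg_pos add_nonneg_nonneg)
  have comb_D: "comb c \<in> D" if "c \<in> cube n" for c
    unfolding comb_def by (rule convex_sum) (use D t_sum t_nonneg that yD in auto)
  have coord: "continuous_on (cube n) (\<lambda>c. c i)" for i
    by (rule continuous_on_product_coordinates[THEN continuous_on_subset]) auto
  have cont_comb: "continuous_on (cube n) comb"
    unfolding comb_def t_def S_def
    by (intro continuous_intros coord) auto

  \<comment> \<open>Schauder weights: only the net points within \<open>e\<close> of \<open>z\<close> get positive weight.\<close>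
  define g where "g z i = max 0 (e - norm (z - y i))" for z i
  define w where "w z i = (if i < n then g z i / (\<Sum>j<n. g z j) else 0)" for z i
  have g_pos: "0 < (\<Sum>j<n. g z j)" if "z \<in> K" for z
  proof -
    have "z \<in> (\<Union>i\<in>{..<n}. ball (y i) e)" using subsetD[OF Y(3) that] by (simp add: y)
    then obtain j where "j < n" "norm (z - y j) < e"
      by (auto simp: dist_norm norm_minus_commute)
    then show ?thesis by (intro sum_pos2[of _ j]) (auto simp: g_def)
  qed
  have w_sum: "(\<Sum>i<n. w z i) = 1" if "z \<in> K" for z
    using g_pos[OF that] by (simp add: w_def flip: sum_divide_distrib)
  have w_nonneg: "0 \<le> w z i" for z i
    by (auto simp: w_def g_def intro!: divide_nonneg_nonneg sum_nonneg)
  have w_cube: "w z \<in> cube n" if "z \<in> K" for z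
  proof -
    have "w z i \<le> 1" if "i < n" for i
      using member_le_sum[of i "{..<n}" "w z"] that w_nonneg w_sum[OF \<open>z \<in> K\<close>] by auto
    moreover have "w z i = 0" if "n \<le> i" for i using that by (simp add: w_def)
    ultimately show ?thesis using w_nonneg by (simp add: cube_def)
  qed
  have cont_w: "continuous_on K (\<lambda>z. w z i)" for i
    unfolding w_def g_def using g_pos[unfolded g_def]
    by (cases "i < n") (auto intro!: continuous_intros simp: less_imp_neq[symmetric])

  define G where "G c = w (F (comb c))" for c
  have FK: "F (comb c) \<in> K" if "c \<in> cube n" for c using comb_D[OF that] K(3) by auto
  have "continuous_on (cube n) (\<lambda>c. F (comb c))"
    by (rule continuous_on_compose2[OF cont cont_comb]) (use comb_D in auto)
  then have "continuous_on (cube n) G"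
    unfolding G_def
    by (intro continuous_on_coordinatewise_then_product continuous_on_compose2[OF cont_w])
      (use FK in auto)
  moreover have "G \<in> cube n \<rightarrow> cube n" using FK w_cube by (auto simp: G_def)
  ultimately obtain c where c: "c \<in> cube n" "G c = c" by (rule brouwer_cube)
  define z where "z = F (comb c)"
  have z: "z \<in> K" and cw: "c = w z" using c FK by (auto simp: z_def G_def)
  have "S c = 1" using w_sum[OF z] by (simp add: S_def cw)
  then have "comb c = (\<Sum>i<n. w z i *\<^sub>R y i)" by (simp add: comb_def t_def flip: cw)
  then have "comb c - z = (\<Sum>i<n. w z i *\<^sub>R (y i - z))"
    using w_sum[OF z] by (simp add: scaleR_diff_right sum_subtractf flip: scaleR_left.sum)
  also have "norm \<dots> \<le> (\<Sum>i<n. w z i * e)"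
  proof (rule sum_norm_le)
    fix i assume "i \<in> {..<n}"
    show "norm (w z i *\<^sub>R (y i - z)) \<le> w z i * e"
    proof (cases "norm (z - y i) < e")
      case True
      then show ?thesis using w_nonneg[of z i] by (simp add: norm_minus_commute mult_left_mono)
    next
      case False
      then show ?thesis by (simp add: w_def g_def)
    qed
  qed
  also have "\<dots> = e" using w_sum[OF z] by (simp flip: sum_distrib_right)
  finally show thesis using that[of "comb c"] comb_D[OF c(1)] by (simp add: z_def)
qed

text \<open>
  Since \<open>F\<close> takes values in the compact set \<open>K \<subseteq> D\<close>, approximate fixed points accumulate at a fixed
  point; \<open>D\<close> itself may fail to be closed.
\<close>

theorem schauder:
  fixes F :: "'a::real_normed_vector \<Rightarrow> 'a"
  assumes D: "convex D" "D \<noteq> {}" and cont: "continuous_on D F"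
    and K: "compact K" "K \<subseteq> D" "F \<in> D \<rightarrow> K"
  obtains x where "x \<in> D" "F x = x"
proof -
  have "\<exists>x. x \<in> D \<and> norm (x - F x) \<le> 1 / real (Suc k)" for k
    using schauder_approx[OF D cont K, of "1 / real (Suc k)"] by auto
  then obtain x where x: "\<And>k. x k \<in> D" "\<And>k. norm (x k - F (x k)) \<le> 1 / real (Suc k)" by metis
  have "\<And>k. F (x k) \<in> K" using x K(3) by auto
  then obtain z r where z: "z \<in> K" and r: "strict_mono (r :: nat \<Rightarrow> nat)"
    and lim: "(\<lambda>k. F (x (r k))) \<longlonglongrightarrow> z"
    using compact_imp_seq_compact[OF K(1)] unfolding seq_compact_def comp_def by meson
  have "(\<lambda>k. 1 / real (Suc (r k))) \<longlonglongrightarrow> 0"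
    using LIMSEQ_subseq_LIMSEQ[OF LIMSEQ_Suc[OF lim_1_over_n] r] by (simp add: comp_def)
  then have "(\<lambda>k. x (r k) - F (x (r k))) \<longlonglongrightarrow> 0"
    by (rule Lim_null_comparison[rotated]) (use x in auto)
  then have "(\<lambda>k. x (r k)) \<longlonglongrightarrow> z" using tendsto_add[OF _ lim] by fastforce
  then have "(\<lambda>k. F (x (r k))) \<longlonglongrightarrow> F z"
    using continuous_on_tendsto_compose[OF cont, of "\<lambda>k. x (r k)" z sequentially] x z K(2) by auto
  then have "F z = z" using lim by (rule LIMSEQ_unique)
  with subsetD[OF K(2) z] show thesis by (rule that)
qed

section \<open>The Birkhoff--Kellogg theorem in a cone\<close>

text \<open>
  The direction \<open>e\<close>, along which the norm is additive on the cone, makes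
  \<open>r v = v + (\<rho> - norm v) e\<close> a retraction of the convex set \<open>P \<inter> cball 0 \<rho>\<close> onto \<open>P \<inter> sphere 0 \<rho>\<close>.
  The bound \<open>m\<close> keeps the normalisation \<open>N\<close> continuous on a compact set that contains all values
  of \<open>T\<close>.
\<close>

theorem birkhoff_kellogg_cone:
  fixes T :: "'a::real_normed_vector \<Rightarrow> 'a"
  assumes P: "convex P" "closed P" "\<And>c x. 0 \<le> c \<Longrightarrow> x \<in> P \<Longrightarrow> c *\<^sub>R x \<in> P"
    and e: "e \<in> P" "\<And>c x. 0 \<le> c \<Longrightarrow> x \<in> P \<Longrightarrow> norm (x + c *\<^sub>R e) = norm x + c"
    and \<rho>: "0 < \<rho>"
    and cont: "continuous_on (P \<inter> sphere 0 \<rho>) T"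
    and K: "compact K" "T \<in> P \<inter> sphere 0 \<rho> \<rightarrow> P \<inter> K"
    and m: "0 < m" "\<And>u. u \<in> P \<inter> sphere 0 \<rho> \<Longrightarrow> m \<le> norm (T u)"
  obtains l u where "0 < l" "u \<in> P \<inter> sphere 0 \<rho>" "u = l *\<^sub>R T u"
proof -
  define D where "D = P \<inter> cball 0 \<rho>"
  define r where "r v = v + (\<rho> - norm v) *\<^sub>R e" for v
  define N where "N y = (\<rho> / norm y) *\<^sub>R y" for y :: 'a
  define K' where "K' = N ` (P \<inter> {y. m \<le> norm y} \<inter> K)"
  have add: "x + y \<in> P" if "x \<in> P" "y \<in> P" for x y
    using P(3)[OF _ convexD[OF P(1) that, of "1/2" "1/2"], of 2] by (simp add: scaleR_add_right)
  have r_sphere: "r v \<in> P \<inter> sphere 0 \<rho>" if "v \<in> D" for v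
    using that e P(3) by (auto simp: r_def D_def intro!: add)
  have N_sphere: "N y \<in> P \<inter> sphere 0 \<rho>" if "y \<in> P" "m \<le> norm y" for y
    using that P(3) m(1) \<rho> by (auto simp: N_def)
  have D: "convex D" "D \<noteq> {}"
    using P(1) P(3)[OF _ e(1), of 0] \<rho> by (auto simp: D_def intro!: convex_Int exI[of _ 0])
  have cont_N: "continuous_on {y. m \<le> norm y} N"
    unfolding N_def using m(1) by (auto intro!: continuous_intros)
  have "closed (P \<inter> {y. m \<le> norm y})"
    using P(2) by (intro closed_Int closed_Collect_le continuous_intros)
  then have "compact (P \<inter> {y. m \<le> norm y} \<inter> K)"
    using K(1) by (rule closed_Int_compact)
  then have K': "compact K'"
    unfolding K'_def by (intro compact_continuous_image continuous_on_subset[OF cont_N]) auto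
  have sub: "K' \<subseteq> D" using N_sphere by (force simp: K'_def D_def)
  have maps: "(\<lambda>v. N (T (r v))) \<in> D \<rightarrow> K'"
  proof
    fix v assume "v \<in> D"
    then have "T (r v) \<in> P \<inter> {y. m \<le> norm y} \<inter> K"
      using r_sphere[of v] m(2)[of "r v"] funcset_mem[OF K(2), of "r v"] by simp
    then show "N (T (r v)) \<in> K'" unfolding K'_def by (rule imageI)
  qed
  have cont_NT: "continuous_on D (\<lambda>v. N (T (r v)))"
    by (rule continuous_on_compose2[OF cont_N], rule continuous_on_compose2[OF cont])
      (use r_sphere m(2) in \<open>auto simp: r_def intro!: continuous_intros\<close>)
  obtain u where u: "u \<in> D" "N (T (r u)) = u"
    by (rule schauder[OF D cont_NT K' sub maps])
  have TP: "T (r u) \<in> P" "m \<le> norm (T (r u))" using r_sphere[OF u(1)] K(2) m(2) by auto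
  have us: "u \<in> P \<inter> sphere 0 \<rho>" using N_sphere[OF TP] u(2) by simp
  then have "r u = u" by (simp add: r_def)
  then have "0 < norm (T u)" "u = (\<rho> / norm (T u)) *\<^sub>R T u"
    using less_le_trans[OF m(1) TP(2)] u(2) by (simp_all add: N_def)
  with us \<rho> show thesis by (intro that[of "\<rho> / norm (T u)" u] divide_pos_pos)
qed

section \<open>The cone and compact sets in the space of continuous functions\<close>

lemma ev_add: "ev (u + v) t = ev u t + ev v t"
  and ev_scaleR: "ev (c *\<^sub>R u) t = c * ev u t"
  and ev_diff: "ev (u - v) t = ev u t - ev v t"
  by (simp_all add: ev_def)

lemma ev_one: "ev (const_bcontfun 1) t = 1"
  by (simp add: ev_def const_bcontfun.rep_eq)

lemma ev_real_of_ui: "ev u (real_of_ui x) = apply_bcontfun u x"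
  by (simp add: ev_def real_of_ui_inverse)

lemma abs_ev_le_norm: "\<bar>ev u t\<bar> \<le> norm (u::C01)"
  using norm_bounded[of u "ui_of_real t"] by (simp add: ev_def)

lemma norm_C01_le:
  assumes "\<And>t. t \<in> {0..1} \<Longrightarrow> \<bar>ev u t\<bar> \<le> c"
  shows "norm (u::C01) \<le> c"
proof (rule norm_bound)
  fix x
  show "norm (apply_bcontfun u x) \<le> c"
    using assms[of "real_of_ui x"] real_of_ui[of x] by (simp add: ev_real_of_ui)
qed

lemma continuous_on_eval: "continuous_on S (\<lambda>u::C01. ev u t)"
proof (rule continuous_onI)
  fix u and e :: real assume "0 < e"
  then show "\<exists>d>0. \<forall>v\<in>S. dist v u < d \<longrightarrow> dist (ev v t) (ev u t) \<le> e"
    using abs_ev_le_norm[of "_ - u" t]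
    by (intro exI[of _ e]) (auto simp: ev_diff dist_norm intro: order_trans less_imp_le)
qed

lemma order_cone_iff:
  assumes "0 \<le> b" "b \<le> 1"
  shows "u \<in> order_cone b \<sigma> \<longleftrightarrow>
    (\<forall>t\<in>{0..1}. 0 \<le> ev u t) \<and> (\<forall>t\<in>{0..b}. \<sigma> * norm u \<le> ev u t)"
proof -
  have "bdd_below (ev u ` {0..b})"
    by (rule bdd_belowI[of _ "- norm u"]) (use abs_ev_le_norm[of u] in \<open>auto simp: abs_le_iff minus_le_iff\<close>)
  then have "\<sigma> * norm u \<le> (INF t\<in>{0..b}. ev u t) \<longleftrightarrow> (\<forall>t\<in>{0..b}. \<sigma> * norm u \<le> ev u t)"
    using assms by (intro le_cINF_iff) auto
  then show ?thesis by (simp add: order_cone_def)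
qed

lemma closed_order_cone:
  assumes "0 \<le> b" "b \<le> 1"
  shows "closed (order_cone b \<sigma>)"
proof -
  have "order_cone b \<sigma> = (\<Inter>t\<in>{0..1}. {u. 0 \<le> ev u t}) \<inter> (\<Inter>t\<in>{0..b}. {u. \<sigma> * norm u \<le> ev u t})"
    using order_cone_iff[OF assms] by blast
  then show ?thesis
    by (simp only:) (intro closed_Int closed_INT ballI closed_Collect_le continuous_intros continuous_on_eval)
qed

lemma convex_order_cone:
  assumes "0 \<le> b" "b \<le> 1" "0 \<le> \<sigma>"
  shows "convex (order_cone b \<sigma>)"
proof (rule convexI)
  fix u v :: C01 and p q :: real
  assume uv: "u \<in> order_cone b \<sigma>" "v \<in> order_cone b \<sigma>" and pq: "0 \<le> p" "0 \<le> q"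
  note iff = order_cone_iff[OF assms(1,2)]
  have "\<sigma> * norm (p *\<^sub>R u + q *\<^sub>R v) \<le> p * ev u t + q * ev v t" if "t \<in> {0..b}" for t
  proof -
    have "\<sigma> * norm (p *\<^sub>R u + q *\<^sub>R v) \<le> \<sigma> * (p * norm u + q * norm v)"
      using norm_triangle_ineq[of "p *\<^sub>R u" "q *\<^sub>R v"] pq assms(3) by (intro mult_left_mono) auto
    also have "\<dots> = p * (\<sigma> * norm u) + q * (\<sigma> * norm v)" by (simp add: algebra_simps)
    also have "\<dots> \<le> p * ev u t + q * ev v t"
      using uv that pq unfolding iff by (intro add_mono mult_left_mono) auto
    finally show ?thesis .
  qed
  then show "p *\<^sub>R u + q *\<^sub>R v \<in> order_cone b \<sigma>"
    using uv pq unfolding iff by (simp add: ev_add ev_scaleR)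
qed

lemma order_cone_scaleR:
  assumes "0 \<le> b" "b \<le> 1" "0 \<le> c" "u \<in> order_cone b \<sigma>"
  shows "c *\<^sub>R u \<in> order_cone b \<sigma>"
proof -
  have "\<sigma> * (c * norm u) = c * (\<sigma> * norm u)" by simp
  then show ?thesis
    using assms by (simp only: order_cone_iff norm_scaleR abs_of_nonneg ev_scaleR) (simp add: mult_left_mono)
qed

text \<open>
  This is the property of the supremum norm that lets the constant function \<open>1\<close> serve as the
  direction \<open>e\<close> of \<open>birkhoff_kellogg_cone\<close>.
\<close>

lemma norm_add_const:
  assumes "\<And>t. t \<in> {0..1} \<Longrightarrow> 0 \<le> ev u t" "0 \<le> c"
  shows "norm (u + c *\<^sub>R const_bcontfun 1) = norm u + (c::real)"
proof (rule antisym)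
  show "norm (u + c *\<^sub>R const_bcontfun 1) \<le> norm u + c"
    using abs_le_D1[OF abs_ev_le_norm[of u]] assms
    by (intro norm_C01_le) (simp add: ev_add ev_scaleR ev_one)
  have "norm u \<le> norm (u + c *\<^sub>R const_bcontfun 1) - c"
  proof (rule norm_C01_le)
    fix t :: real assume "t \<in> {0..1}"
    then show "\<bar>ev u t\<bar> \<le> norm (u + c *\<^sub>R const_bcontfun 1) - c"
      using abs_ev_le_norm[of "u + c *\<^sub>R const_bcontfun 1" t] assms
      by (simp add: ev_add ev_scaleR ev_one)
  qed
  then show "norm u + c \<le> norm (u + c *\<^sub>R const_bcontfun 1)" by simp
qed

definition hoelder_ball :: "real \<Rightarrow> real \<Rightarrow> real \<Rightarrow> C01 set"
  where "hoelder_ball a M C = {u. norm u \<le> M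
    \<and> (\<forall>s\<in>{0..1}. \<forall>t\<in>{0..1}. \<bar>ev u t - ev u s\<bar> \<le> C * \<bar>t - s\<bar> powr a)}"

text \<open>
  An explicit \<open>d\<close> for the modulus of continuity \<open>C x powr a\<close>; the proof divides by \<open>C + 1\<close> to allow
  \<open>C = 0\<close>.
\<close>

lemma powr_modulus:
  assumes "0 < a" "0 < (e::real)" "0 \<le> C"
  obtains d where "0 < d" "\<And>x. 0 \<le> x \<Longrightarrow> x < d \<Longrightarrow> C * x powr a < e"
proof
  show "0 < (e / (C + 1)) powr (1 / a)" using assms by simp
  fix x :: real assume x: "0 \<le> x" "x < (e / (C + 1)) powr (1 / a)"
  have "x powr a < ((e / (C + 1)) powr (1 / a)) powr a"
    using x assms(1) by (rule powr_less_mono2[rotated])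
  also have "\<dots> = e / (C + 1)" using assms by (simp add: powr_powr)
  finally have "(C + 1) * x powr a < e" using assms by (simp add: field_simps)
  moreover have "C * x powr a \<le> (C + 1) * x powr a" by (intro mult_right_mono) auto
  ultimately show "C * x powr a < e" by simp
qed

text \<open>
  A Hoelder bound makes the family equicontinuous, so Arzela--Ascoli yields a uniformly convergent
  subsequence; the bounds pass to pointwise limits.
\<close>

lemma compact_hoelder_ball:
  assumes "0 < a" "0 \<le> C"
  shows "compact (hoelder_ball a M C)"
proof -
  have "seq_compact (hoelder_ball a M C)"
    unfolding seq_compact_def
  proof (intro allI impI)
    fix u assume u: "\<forall>n::nat. u n \<in> hoelder_ball a M C"
    have bound: "norm (ev (u n) t) \<le> M" for n t
      using u abs_ev_le_norm[of "u n" t] by (simp add: hoelder_ball_def) (meson order_trans)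
    have equi: "\<exists>d>0. \<forall>n t. t \<in> {0..1} \<and> norm (s - t) < d \<longrightarrow> norm (ev (u n) s - ev (u n) t) < e"
      if s: "s \<in> {0..1}" and e: "0 < e" for s e :: real
    proof -
      obtain d where d: "0 < d" "\<And>x. 0 \<le> x \<Longrightarrow> x < d \<Longrightarrow> C * x powr a < e"
        using powr_modulus[OF assms(1) e assms(2)] by blast
      have "norm (ev (u n) s - ev (u n) t) < e" if t: "t \<in> {0..1}" "norm (s - t) < d" for n t
      proof -
        have "norm (ev (u n) s - ev (u n) t) \<le> C * \<bar>s - t\<bar> powr a"
          using u s t(1) by (simp add: hoelder_ball_def)
        also have "\<dots> < e" using t(2) by (intro d(2)) auto
        finally show ?thesis .
      qed
      then show ?thesis using d(1) by blast
    qed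
    obtain g k where g: "continuous_on {0..1} g" and k: "strict_mono (k :: nat \<Rightarrow> nat)"
      and lim: "\<And>e. 0 < e \<Longrightarrow> \<exists>N. \<forall>n t. n \<ge> N \<and> t \<in> {0..1} \<longrightarrow> norm (ev (u (k n)) t - g t) < e"
      by (rule Arzela_Ascoli[of "{0..1::real}" "\<lambda>n. ev (u n)" M]) (use bound equi in auto)
    obtain l :: C01 where l: "\<forall>t\<in>{0..1}. ev l t = g t" using ev_ex[OF g] by blast
    have conv: "(u \<circ> k) \<longlonglongrightarrow> l"
      unfolding tendsto_iff eventually_sequentially
    proof (intro allI impI)
      fix e :: real assume e: "0 < e"
      then obtain N where N: "\<And>n t. n \<ge> N \<Longrightarrow> t \<in> {0..1} \<Longrightarrow> norm (ev (u (k n)) t - g t) < e / 2"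
        using lim[of "e / 2"] by (auto simp: real_norm_def)
      have "dist ((u \<circ> k) n) l < e" if "n \<ge> N" for n
      proof -
        have "norm (u (k n) - l) \<le> e / 2"
          using N[OF that] l by (intro norm_C01_le) (force simp: ev_diff less_imp_le)
        then show ?thesis using e by (simp add: dist_norm)
      qed
      then show "\<exists>N. \<forall>n\<ge>N. dist ((u \<circ> k) n) l < e" by blast
    qed
    have ev_conv: "(\<lambda>n. ev (u (k n)) t) \<longlonglongrightarrow> ev l t" for t
      using continuous_on_tendsto_compose[OF continuous_on_eval[of UNIV t] conv] by (simp add: comp_def)
    have "norm l \<le> M"
      by (rule Lim_bounded[OF tendsto_norm[OF conv], of 0]) (use u in \<open>auto simp: hoelder_ball_def\<close>)
    moreover have "\<bar>ev l t - ev l s\<bar> \<le> C * \<bar>t - s\<bar> powr a" if "s \<in> {0..1}" "t \<in> {0..1}" for s t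
      by (rule Lim_bounded[OF tendsto_rabs[OF tendsto_diff[OF ev_conv ev_conv]], of 0])
        (use u that in \<open>auto simp: hoelder_ball_def\<close>)
    ultimately have "l \<in> hoelder_ball a M C" by (simp add: hoelder_ball_def)
    with conv k show "\<exists>l\<in>hoelder_ball a M C. \<exists>r. strict_mono r \<and> (u \<circ> r) \<longlonglongrightarrow> l" by blast
  qed
  then show ?thesis by (simp add: compact_eq_seq_compact_metric)
qed

section \<open>Estimates for the kernel\<close>

text \<open>
  Truncating the base instead of multiplying by an indicator function gives a continuous function
  on the whole line, so that the kernel needs no case distinction in \<open>s\<close> (\<open>kern_eq\<close> below).
\<close>

definition pos_powr :: "real \<Rightarrow> real \<Rightarrow> real"
  where "pos_powr a x = (max 0 x) powr a"

lemma pos_powr_nonneg [simp]: "0 \<le> pos_powr a x"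
  by (simp add: pos_powr_def)

lemma pos_powr_nonpos [simp]: "x \<le> 0 \<Longrightarrow> pos_powr a x = 0"
  by (simp add: pos_powr_def)

lemma pos_powr_of_nonneg: "0 \<le> x \<Longrightarrow> pos_powr a x = x powr a"
  by (simp add: pos_powr_def)

lemma pos_powr_mono: "0 \<le> a \<Longrightarrow> x \<le> y \<Longrightarrow> pos_powr a x \<le> pos_powr a y"
  unfolding pos_powr_def by (intro powr_mono2) auto

lemma continuous_on_pos_powr:
  assumes "0 < a" "continuous_on S g"
  shows "continuous_on S (\<lambda>x. pos_powr a (g x))"
  unfolding pos_powr_def using assms by (intro continuous_on_powr' continuous_intros) auto

text \<open>
  Subadditivity. For \<open>0 < y < x\<close> the fractions \<open>q = y / x\<close> and \<open>q = (x - y) / x\<close> add up to \<open>1\<close>, and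
  \<open>q \<le> q powr a\<close> because \<open>a \<le> 1\<close>.
\<close>

lemma pos_powr_diff_le:
  assumes "0 < a" "a \<le> 1"
  shows "pos_powr a x - pos_powr a y \<le> pos_powr a (x - y)"
proof (cases "0 < y \<and> y < x")
  case True
  have ge: "q \<le> q powr a" if "0 \<le> q" "q \<le> 1" for q
    using powr_mono'[of a 1 q] assms that by simp
  have "x powr a \<le> x powr a * ((y / x) powr a + ((x - y) / x) powr a)"
  proof -
    have "1 = y / x + (x - y) / x" using True by (simp add: field_simps)
    also have "\<dots> \<le> (y / x) powr a + ((x - y) / x) powr a"
      using True by (intro add_mono ge) (auto simp: field_simps)
    finally show ?thesis using mult_left_mono[of 1 _ "x powr a"] by simp
  qed
  also have "\<dots> = y powr a + (x - y) powr a"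
    using True by (simp add: powr_divide distrib_left)
  finally show ?thesis using True by (simp add: pos_powr_of_nonneg)
next
  case False
  then show ?thesis
  proof (cases "x \<le> y")
    case True
    then show ?thesis using pos_powr_mono[OF _ True, of a] assms by simp
  next
    case not_le: False
    with False show ?thesis using pos_powr_mono[of a x "x - y"] assms by simp
  qed
qed

lemma abs_pos_powr_diff_le:
  assumes "0 < a" "a \<le> 1"
  shows "\<bar>pos_powr a x - pos_powr a y\<bar> \<le> \<bar>x - y\<bar> powr a"
proof -
  have "pos_powr a (x - y) \<le> \<bar>x - y\<bar> powr a" "pos_powr a (y - x) \<le> \<bar>x - y\<bar> powr a"
    using pos_powr_mono[of a _ "\<bar>x - y\<bar>"] assms(1) by (simp_all add: pos_powr_of_nonneg)
  then show ?thesis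
    using pos_powr_diff_le[OF assms, of x y] pos_powr_diff_le[OF assms, of y x] by linarith
qed

lemma kern_eq:
  assumes "0 \<le> s"
  shows "kern \<alpha> \<beta> \<eta> t s =
    \<beta> + (pos_powr (\<alpha> - 1) (\<eta> - s) - pos_powr (\<alpha> - 1) (t - s)) / Gamma \<alpha>"
  using assms by (simp add: kern_def pos_powr_def indicator_def max_def diff_divide_distrib)

locale caputo_bvp =
  fixes \<alpha> \<beta> \<eta> b :: real
  assumes \<alpha>: "1 < \<alpha>" "\<alpha> \<le> 2" and \<eta>: "0 < \<eta>" "\<eta> < 1" and \<beta>: "0 < \<beta>"
    and \<beta>_ge: "beta_K \<alpha> \<eta> \<le> \<beta>" "beta_gam \<alpha> \<eta> \<le> \<beta>"
    and b: "\<eta> \<le> b" "b < 1"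
begin

abbreviation K where "K \<equiv> kern \<alpha> \<beta> \<eta>"
abbreviation \<gamma> where "\<gamma> \<equiv> gam \<alpha> \<beta> \<eta>"
abbreviation \<sigma> where "\<sigma> \<equiv> sigma2 \<alpha> \<beta> \<eta> b"
abbreviation Kmax where "Kmax \<equiv> \<beta> + \<eta> powr (\<alpha> - 1) / Gamma \<alpha>"

lemma Gamma_pos: "0 < Gamma \<alpha>" "0 < Gamma (3 - \<alpha>)"
  using \<alpha> by (auto intro!: Gamma_real_pos)

text \<open>
  Subadditivity for \<open>t - s = (t - \<eta>) + (\<eta> - s)\<close> removes \<open>s\<close>; positivity and the cone inequality of
  the kernel both follow from this bound.
\<close>

lemma kern_lower:
  assumes "0 \<le> s" shows "\<beta> - pos_powr (\<alpha> - 1) (t - \<eta>) / Gamma \<alpha> \<le> K t s"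
proof -
  have "pos_powr (\<alpha> - 1) (t - s) - pos_powr (\<alpha> - 1) (\<eta> - s) \<le> pos_powr (\<alpha> - 1) (t - \<eta>)"
    using pos_powr_diff_le[of "\<alpha> - 1" "t - s" "\<eta> - s"] \<alpha> by simp
  then have "(pos_powr (\<alpha> - 1) (t - s) - pos_powr (\<alpha> - 1) (\<eta> - s)) / Gamma \<alpha>
      \<le> pos_powr (\<alpha> - 1) (t - \<eta>) / Gamma \<alpha>"
    using Gamma_pos(1) by (intro divide_right_mono) auto
  then show ?thesis unfolding kern_eq[OF assms] by (simp add: diff_divide_distrib)
qed

lemma kern_nonneg:
  assumes "t \<in> {0..1}" "0 \<le> s" shows "0 \<le> K t s"
proof -
  have "pos_powr (\<alpha> - 1) (t - \<eta>) / Gamma \<alpha> \<le> beta_K \<alpha> \<eta>"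
    using pos_powr_mono[of "\<alpha> - 1" "t - \<eta>" "1 - \<eta>"] assms(1) \<alpha> \<eta> Gamma_pos(1)
    unfolding beta_K_def by (intro divide_right_mono) (auto simp: pos_powr_of_nonneg)
  then show ?thesis using kern_lower[OF assms(2), of t] \<beta>_ge(1) by linarith
qed

lemma kern_upper:
  assumes "0 \<le> s" shows "K t s \<le> Kmax"
proof -
  have "pos_powr (\<alpha> - 1) (\<eta> - s) - pos_powr (\<alpha> - 1) (t - s) \<le> \<eta> powr (\<alpha> - 1)"
    using pos_powr_mono[of "\<alpha> - 1" "\<eta> - s" \<eta>] assms \<alpha> \<eta>
    by (simp add: pos_powr_of_nonneg add_increasing2 diff_le_eq)
  then show ?thesis unfolding kern_eq[OF assms] using Gamma_pos(1)
    by (intro add_left_mono divide_right_mono) auto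
qed

lemma Kmax_pos: "0 < Kmax"
  using \<beta> Gamma_pos(1) by (intro add_pos_nonneg) auto

lemma abs_kern_le: "t \<in> {0..1} \<Longrightarrow> 0 \<le> s \<Longrightarrow> \<bar>K t s\<bar> \<le> Kmax"
  using kern_nonneg kern_upper by simp

lemma kern_hoelder:
  assumes "0 \<le> s" shows "\<bar>K t s - K t' s\<bar> \<le> \<bar>t - t'\<bar> powr (\<alpha> - 1) / Gamma \<alpha>"
proof -
  have "K t s - K t' s = (pos_powr (\<alpha> - 1) (t' - s) - pos_powr (\<alpha> - 1) (t - s)) / Gamma \<alpha>"
    unfolding kern_eq[OF assms] by (simp add: diff_divide_distrib)
  then have "\<bar>K t s - K t' s\<bar> = \<bar>pos_powr (\<alpha> - 1) (t' - s) - pos_powr (\<alpha> - 1) (t - s)\<bar> / Gamma \<alpha>"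
    using Gamma_pos(1) by simp
  also have "\<dots> \<le> \<bar>t - t'\<bar> powr (\<alpha> - 1) / Gamma \<alpha>"
    using abs_pos_powr_diff_le[of "\<alpha> - 1" "t' - s" "t - s"] \<alpha> Gamma_pos(1)
    by (intro divide_right_mono) (auto simp: abs_minus_commute)
  finally show ?thesis .
qed

lemma continuous_on_kern: "continuous_on {0..c} (K t)"
proof (rule continuous_on_eq)
  show "continuous_on {0..c} (\<lambda>s. \<beta> +
      (pos_powr (\<alpha> - 1) (\<eta> - s) - pos_powr (\<alpha> - 1) (t - s)) / Gamma \<alpha>)"
    using \<alpha> less_imp_neq[OF Gamma_pos(1)]
    by (intro continuous_intros continuous_on_pos_powr) auto
qed (simp add: kern_eq)

lemma c2K_nonneg: "0 \<le> c2K \<alpha> \<beta> \<eta> b"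
proof -
  have "(b - \<eta>) powr (\<alpha> - 1) \<le> (1 - \<eta>) powr (\<alpha> - 1)"
    using b \<alpha> by (intro powr_mono2) auto
  also have "\<dots> \<le> \<beta> * Gamma \<alpha>"
    using \<beta>_ge(1) Gamma_pos(1) by (simp add: beta_K_def field_simps)
  finally show ?thesis
    unfolding c2K_def using \<beta> Gamma_pos(1) by (intro divide_nonneg_nonneg) auto
qed

text \<open>
  The constant \<open>c2K\<close> is the quotient of the lower bound of \<open>kern_lower\<close> at \<open>t = b\<close> and of the upper
  bound \<open>Kmax\<close>.
\<close>

lemma kern_cone:
  assumes "t \<in> {0..b}" "0 \<le> s"
  shows "c2K \<alpha> \<beta> \<eta> b * K \<tau> s \<le> K t s"
proof -
  have "0 < \<beta> * Gamma \<alpha> + \<eta> powr (\<alpha> - 1)"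
    using \<beta> Gamma_pos(1) by (intro add_pos_nonneg) auto
  moreover have "Kmax = (\<beta> * Gamma \<alpha> + \<eta> powr (\<alpha> - 1)) / Gamma \<alpha>"
    using Gamma_pos(1) by (simp add: field_simps)
  ultimately have eq: "c2K \<alpha> \<beta> \<eta> b * Kmax = (\<beta> * Gamma \<alpha> - (b - \<eta>) powr (\<alpha> - 1)) / Gamma \<alpha>"
    by (simp add: c2K_def)
  have "c2K \<alpha> \<beta> \<eta> b * K \<tau> s \<le> c2K \<alpha> \<beta> \<eta> b * Kmax"
    using c2K_nonneg kern_upper[OF assms(2)] by (rule mult_left_mono[rotated])
  also have "\<dots> = \<beta> - pos_powr (\<alpha> - 1) (b - \<eta>) / Gamma \<alpha>"
    using b Gamma_pos(1) unfolding eq by (simp add: pos_powr_of_nonneg diff_divide_distrib)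
  also have "\<dots> \<le> \<beta> - pos_powr (\<alpha> - 1) (t - \<eta>) / Gamma \<alpha>"
    using pos_powr_mono[of "\<alpha> - 1" "t - \<eta>" "b - \<eta>"] assms(1) \<alpha> Gamma_pos(1)
    by (intro diff_left_mono divide_right_mono) auto
  also have "\<dots> \<le> K t s" by (rule kern_lower[OF assms(2)])
  finally show ?thesis .
qed

lemma gam_nonneg:
  assumes "t \<le> 1" shows "0 \<le> \<gamma> t"
proof -
  have "1 - \<eta> \<le> \<beta> / Gamma (3 - \<alpha>)"
    using \<beta>_ge(2) Gamma_pos(2) by (simp add: beta_gam_def le_divide_eq)
  then show ?thesis using assms by (simp add: gam_def)
qed

lemma gam_antimono: "s \<le> t \<Longrightarrow> \<gamma> t \<le> \<gamma> s"
  by (simp add: gam_def)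

text \<open>
  In this form the constant is recognised as the minimum over \<open>[0,b]\<close> divided by the maximum over
  \<open>[0,1]\<close> of the decreasing function \<open>\<gamma>\<close>.
\<close>

lemma sigma2_gam_eq: "sigma2_gam \<alpha> \<beta> \<eta> b = \<gamma> b / \<gamma> 0"
proof -
  have "\<beta> + (\<eta> - b) * Gamma (3 - \<alpha>) = \<gamma> b * Gamma (3 - \<alpha>)"
    "\<beta> + \<eta> * Gamma (3 - \<alpha>) = \<gamma> 0 * Gamma (3 - \<alpha>)"
    using Gamma_pos(2) by (simp_all add: gam_def field_simps)
  then show ?thesis using Gamma_pos(2) by (simp add: sigma2_gam_def)
qed

lemma gam_0_pos: "0 < \<gamma> 0"
  using \<beta> \<eta> Gamma_pos(2) by (simp add: gam_def add_pos_pos)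

lemma gam_cone:
  assumes "t \<le> b" "0 \<le> \<tau>"
  shows "sigma2_gam \<alpha> \<beta> \<eta> b * \<gamma> \<tau> \<le> \<gamma> t"
proof -
  have "sigma2_gam \<alpha> \<beta> \<eta> b * \<gamma> \<tau> \<le> sigma2_gam \<alpha> \<beta> \<eta> b * \<gamma> 0"
    using gam_nonneg[of b] gam_nonneg[of 0] b gam_antimono[OF assms(2)]
    by (intro mult_left_mono) (auto simp: sigma2_gam_eq)
  also have "\<dots> = \<gamma> b" using gam_0_pos by (simp add: sigma2_gam_eq)
  also have "\<dots> \<le> \<gamma> t" using assms(1) by (rule gam_antimono)
  finally show ?thesis .
qed

lemma sigma2_bounds:
  "0 \<le> \<sigma>" "\<sigma> \<le> 1" "\<sigma> \<le> c2K \<alpha> \<beta> \<eta> b" "\<sigma> \<le> sigma2_gam \<alpha> \<beta> \<eta> b"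
  using c2K_nonneg gam_nonneg[of b] gam_nonneg[of 0] b
  by (auto simp: sigma2_def sigma2_gam_eq)

end

section \<open>The integral operator\<close>

lemma compact_map_bounded:
  assumes "compact_map H" "bounded B"
  shows "bounded (H ` B)"
proof (rule bounded_subset[OF _ closure_subset])
  show "bounded (closure (H ` B))"
    using assms by (intro compact_imp_bounded) (simp add: compact_map_def)
qed

locale caputo_bvp_data = caputo_bvp +
  fixes f :: "real \<Rightarrow> real \<Rightarrow> real" and H1 H2 :: "C01 \<Rightarrow> real"
  assumes f_cont: "continuous_on ({0..1} \<times> UNIV) (\<lambda>(t, x). f t x)"
    and f_nonneg: "\<And>t x. t \<in> {0..1} \<Longrightarrow> 0 \<le> f t x"
    and H1: "compact_map H1" "\<And>u. 0 \<le> H1 u"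
    and H2: "compact_map H2" "\<And>u. 0 \<le> H2 u"
begin

abbreviation Op where "Op \<equiv> bvp_op \<alpha> \<beta> \<eta> f H1 H2"

lemma f_cont_box: "continuous_on ({0..1} \<times> {-R..R}) (\<lambda>(t, x). f t x)"
  by (rule continuous_on_subset[OF f_cont]) auto

lemma ev_in: "norm u \<le> R \<Longrightarrow> ev u s \<in> {-R..R}"
  using abs_ev_le_norm[of u s] by auto

lemma f_bounded:
  "\<exists>M\<ge>0. \<forall>u s. norm u \<le> R \<longrightarrow> s \<in> {0..1} \<longrightarrow> f s (ev u s) \<le> M"
proof -
  have "compact ((\<lambda>(t, x). f t x) ` ({0..1} \<times> {-R..R}))"
    by (intro compact_continuous_image f_cont_box compact_Times) auto
  from compact_imp_bounded[OF this]
  obtain M where M: "\<And>z. z \<in> {0..1} \<times> {-R..R} \<Longrightarrow> norm (case z of (t, x) \<Rightarrow> f t x) \<le> M"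
    unfolding bounded_iff ball_simps by blast
  show ?thesis
  proof (intro exI[of _ "max 0 M"] conjI allI impI)
    fix u s assume "norm (u::C01) \<le> R" "s \<in> {0..1::real}"
    then show "f s (ev u s) \<le> max 0 M" using M[of "(s, ev u s)"] ev_in[of u R s] by auto
  qed simp
qed

lemma continuous_on_f_ev: "continuous_on {0..1} (\<lambda>s. f s (ev u s))"
proof -
  have "continuous_on {0..1} (\<lambda>s. (s, ev u s))" by (intro continuous_intros continuous_on_ev)
  from continuous_on_compose2[OF f_cont this] show ?thesis by auto
qed

lemma integrable_kern_f: "(\<lambda>s. K t s * f s (ev u s)) integrable_on {0..1}"
  by (intro integrable_continuous_interval continuous_intros continuous_on_kern continuous_on_f_ev)

lemma integral_kern_f_nonneg:
  "t \<in> {0..1} \<Longrightarrow> 0 \<le> integral {0..1} (\<lambda>s. K t s * f s (ev u s))"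
  by (intro integral_nonneg integrable_kern_f) (auto intro!: mult_nonneg_nonneg kern_nonneg f_nonneg)

lemma Op_nonneg: "t \<in> {0..1} \<Longrightarrow> 0 \<le> Op u t"
  unfolding bvp_op_def
  using H1(2) H2(2) gam_nonneg by (intro add_nonneg_nonneg mult_nonneg_nonneg integral_kern_f_nonneg) auto

text \<open>
  Each of the three terms of the operator satisfies the inequality with its own constant
  \<open>sigma2_gam\<close>, \<open>1\<close> or \<open>c2K\<close>, and \<open>sigma2\<close> is the least of these. Taking the supremum over \<open>\<tau>\<close> shows
  that the operator maps into the cone.
\<close>

lemma Op_cone:
  assumes t: "t \<in> {0..b}" and \<tau>: "\<tau> \<in> {0..1}"
  shows "\<sigma> * Op u \<tau> \<le> Op u t"
proof -
  have t1: "t \<in> {0..1}" using t b by auto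
  have "\<sigma> * \<gamma> \<tau> \<le> sigma2_gam \<alpha> \<beta> \<eta> b * \<gamma> \<tau>"
    using sigma2_bounds(4) gam_nonneg \<tau> by (intro mult_right_mono) auto
  also have "\<dots> \<le> \<gamma> t" using t \<tau> by (intro gam_cone) auto
  finally have g: "H1 u * (\<sigma> * \<gamma> \<tau>) \<le> H1 u * \<gamma> t" using H1(2) by (intro mult_left_mono)
  have h: "\<sigma> * H2 u \<le> H2 u" using sigma2_bounds(2) H2(2) mult_right_mono[of \<sigma> 1 "H2 u"] by simp
  have "\<sigma> * integral {0..1} (\<lambda>s. K \<tau> s * f s (ev u s)) = integral {0..1} (\<lambda>s. \<sigma> * (K \<tau> s * f s (ev u s)))"
    by simp
  also have "\<dots> \<le> integral {0..1} (\<lambda>s. K t s * f s (ev u s))"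
  proof (rule integral_le)
    fix s :: real assume s: "s \<in> {0..1}"
    then have "\<sigma> * K \<tau> s \<le> c2K \<alpha> \<beta> \<eta> b * K \<tau> s"
      using sigma2_bounds(3) kern_nonneg[OF \<tau>] by (intro mult_right_mono) auto
    also have "\<dots> \<le> K t s" using t s by (intro kern_cone) auto
    finally have "\<sigma> * K \<tau> s * f s (ev u s) \<le> K t s * f s (ev u s)"
      using f_nonneg[OF s] by (rule mult_right_mono)
    then show "\<sigma> * (K \<tau> s * f s (ev u s)) \<le> K t s * f s (ev u s)" by (simp add: mult.assoc)
  qed (use integrable_kern_f in \<open>auto intro!: integrable_on_mult_right\<close>)
  finally show ?thesis unfolding bvp_op_def using g h by (simp add: algebra_simps)
qed

lemma abs_integral_le:
  fixes g :: "real \<Rightarrow> real"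
  assumes "g integrable_on {0..1}" "\<And>s. s \<in> {0..1} \<Longrightarrow> \<bar>g s\<bar> \<le> c"
  shows "\<bar>integral {0..1} g\<bar> \<le> c"
  using integral_norm_bound_integral[OF assms(1) integrable_continuous_interval[OF continuous_on_const], of c] assms(2)
  by simp

lemma Op_le:
  assumes "\<And>s. s \<in> {0..1} \<Longrightarrow> f s (ev u s) \<le> M" "0 \<le> M" "t \<in> {0..1}"
  shows "Op u t \<le> H1 u * \<gamma> 0 + H2 u + Kmax * M"
proof -
  have "H1 u * \<gamma> t \<le> H1 u * \<gamma> 0"
    using H1(2) assms(3) by (intro mult_left_mono gam_antimono) auto
  moreover have "\<bar>integral {0..1} (\<lambda>s. K t s * f s (ev u s))\<bar> \<le> Kmax * M"
  proof (intro abs_integral_le integrable_kern_f)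
    fix s :: real assume s: "s \<in> {0..1}"
    then show "\<bar>K t s * f s (ev u s)\<bar> \<le> Kmax * M"
      unfolding abs_mult using f_nonneg[OF s] assms(1)[OF s] abs_kern_le[OF assms(3), of s] Kmax_pos
      by (intro mult_mono) auto
  qed
  ultimately show ?thesis unfolding bvp_op_def by linarith
qed

text \<open>
  The function \<open>\<gamma>\<close> has slope \<open>-1\<close>, and on the unit interval \<open>\<bar>t - t'\<bar> \<le> \<bar>t - t'\<bar> powr (\<alpha> - 1)\<close>, so both
  terms that depend on \<open>t\<close> share the exponent \<open>\<alpha> - 1\<close>.
\<close>

lemma Op_hoelder:
  assumes M: "\<And>s. s \<in> {0..1} \<Longrightarrow> f s (ev u s) \<le> M" and "0 \<le> M"
    and t: "t \<in> {0..1}" "t' \<in> {0..1}"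
  shows "\<bar>Op u t - Op u t'\<bar> \<le> (H1 u + M / Gamma \<alpha>) * \<bar>t - t'\<bar> powr (\<alpha> - 1)"
proof -
  let ?h = "\<bar>t - t'\<bar> powr (\<alpha> - 1)"
  have "\<bar>t - t'\<bar> powr 1 \<le> ?h" using \<alpha> t by (intro powr_mono') auto
  then have "\<bar>H1 u * (\<gamma> t - \<gamma> t')\<bar> \<le> H1 u * ?h"
    unfolding abs_mult using H1(2)[of u] by (intro mult_mono) (auto simp: gam_def)
  moreover have "\<bar>integral {0..1} (\<lambda>s. K t s * f s (ev u s) - K t' s * f s (ev u s))\<bar>
      \<le> ?h / Gamma \<alpha> * M"
  proof (intro abs_integral_le integrable_diff integrable_kern_f)
    fix s :: real assume s: "s \<in> {0..1}"
    have "\<bar>K t s - K t' s\<bar> * \<bar>f s (ev u s)\<bar> \<le> ?h / Gamma \<alpha> * M"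
      using f_nonneg[OF s] M[OF s] kern_hoelder[of s t t'] s Gamma_pos(1) by (intro mult_mono) auto
    then show "\<bar>K t s * f s (ev u s) - K t' s * f s (ev u s)\<bar> \<le> ?h / Gamma \<alpha> * M"
      by (simp flip: abs_mult left_diff_distrib)
  qed
  moreover have "Op u t - Op u t' = H1 u * (\<gamma> t - \<gamma> t')
      + integral {0..1} (\<lambda>s. K t s * f s (ev u s) - K t' s * f s (ev u s))"
    unfolding bvp_op_def integral_diff[OF integrable_kern_f integrable_kern_f]
      by (simp add: right_diff_distrib left_diff_distrib)
  ultimately have "\<bar>Op u t - Op u t'\<bar> \<le> H1 u * ?h + ?h / Gamma \<alpha> * M" by linarith
  then show ?thesis by (simp add: algebra_simps)
qed

lemma continuous_on_Op: "continuous_on {0..1} (Op u)"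
proof (rule continuous_onI)
  fix t e :: real assume t: "t \<in> {0..1}" and e: "0 < e"
  obtain M where "0 \<le> M"
    and "\<And>v s. norm v \<le> norm u \<Longrightarrow> s \<in> {0..1} \<Longrightarrow> f s (ev v s) \<le> M"
    using f_bounded[of "norm u"] by blast
  note M = \<open>0 \<le> M\<close> this(2)[OF order_refl]
  have "0 \<le> H1 u + M / Gamma \<alpha>" using H1(2) M(1) Gamma_pos(1) by simp
  then obtain d where d: "0 < d"
    "\<And>x. 0 \<le> x \<Longrightarrow> x < d \<Longrightarrow> (H1 u + M / Gamma \<alpha>) * x powr (\<alpha> - 1) < e"
    using powr_modulus[of "\<alpha> - 1" e] \<alpha> e by auto
  have "dist (Op u t') (Op u t) \<le> e" if "t' \<in> {0..1}" "dist t' t < d" for t'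
    using Op_hoelder[OF M(2,1) that(1) t] d(2)[of "\<bar>t' - t\<bar>"] that(2) by (simp add: dist_real_def)
  then show "\<exists>d>0. \<forall>t'\<in>{0..1}. dist t' t < d \<longrightarrow> dist (Op u t') (Op u t) \<le> e"
    using d(1) by blast
qed

text \<open>
  The operator as a map of \<open>C[0,1]\<close> to itself; the choice is legitimate since \<open>Op u\<close> is continuous.
\<close>

definition T :: "C01 \<Rightarrow> C01"
  where "T u = (SOME w. \<forall>t\<in>{0..1}. ev w t = Op u t)"

lemma ev_T: "t \<in> {0..1} \<Longrightarrow> ev (T u) t = Op u t"
  unfolding T_def using someI_ex[OF ev_ex[OF continuous_on_Op[of u]]] by blast

lemma T_in_cone: "T u \<in> order_cone b \<sigma>"
proof -
  have b01: "0 \<le> b" "b \<le> 1" using b \<eta> by auto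
  have "\<sigma> * norm (T u) \<le> ev (T u) t" if t: "t \<in> {0..b}" for t
  proof (cases "\<sigma> = 0")
    case True
    then show ?thesis using ev_T[of t u] Op_nonneg[of t u] t b by simp
  next
    case False
    then have \<sigma>: "0 < \<sigma>" using sigma2_bounds(1) by simp
    have "norm (T u) \<le> Op u t / \<sigma>"
    proof (rule norm_C01_le)
      fix \<tau> :: real assume \<tau>: "\<tau> \<in> {0..1}"
      show "\<bar>ev (T u) \<tau>\<bar> \<le> Op u t / \<sigma>"
        using Op_cone[OF t \<tau>, of u] Op_nonneg[OF \<tau>, of u] ev_T[OF \<tau>, of u] \<sigma>
        by (simp add: le_divide_eq mult.commute)
    qed
    then show ?thesis using \<sigma> ev_T[of t u] t b by (simp add: le_divide_eq mult.commute)
  qed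
  then show ?thesis using order_cone_iff[OF b01] Op_nonneg ev_T by simp
qed

lemma T_into_hoelder_ball:
  obtains M C where "0 \<le> C" "T ` cball 0 R \<subseteq> hoelder_ball (\<alpha> - 1) M C"
proof -
  obtain M where M: "0 \<le> M" "\<And>u s. norm u \<le> R \<Longrightarrow> s \<in> {0..1} \<Longrightarrow> f s (ev u s) \<le> M"
    using f_bounded[of R] by blast
  have bdd: "\<exists>h. \<forall>u\<in>cball 0 R. \<bar>H u\<bar> \<le> h" if "compact_map H" for H :: "C01 \<Rightarrow> real"
    using compact_map_bounded[OF that bounded_cball[of 0 R]] by (simp add: bounded_iff)
  obtain h1 h2 where h: "\<And>u. u \<in> cball 0 R \<Longrightarrow> \<bar>H1 u\<bar> \<le> h1" "\<And>u. u \<in> cball 0 R \<Longrightarrow> \<bar>H2 u\<bar> \<le> h2"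
    using bdd[OF H1(1)] bdd[OF H2(1)] by blast
  let ?C = "max 0 h1 + M / Gamma \<alpha>"
  have "T u \<in> hoelder_ball (\<alpha> - 1) (max 0 h1 * \<gamma> 0 + h2 + Kmax * M) ?C" if u: "u \<in> cball 0 R" for u
  proof -
    have Mu: "f s (ev u s) \<le> M" if "s \<in> {0..1}" for s using M(2)[OF _ that, of u] u by simp
    have "\<bar>ev (T u) t\<bar> \<le> max 0 h1 * \<gamma> 0 + h2 + Kmax * M" if t: "t \<in> {0..1}" for t
    proof -
      have "H1 u * \<gamma> 0 \<le> max 0 h1 * \<gamma> 0" using h(1)[OF u] gam_0_pos by (intro mult_right_mono) auto
      then show ?thesis using ev_T[OF t, of u] Op_nonneg[OF t, of u] Op_le[OF Mu M(1) t] h(2)[OF u] by linarith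
    qed
    moreover have "\<bar>ev (T u) t - ev (T u) s\<bar> \<le> ?C * \<bar>t - s\<bar> powr (\<alpha> - 1)"
      if "t \<in> {0..1}" "s \<in> {0..1}" for t s
    proof -
      have "(H1 u + M / Gamma \<alpha>) * \<bar>t - s\<bar> powr (\<alpha> - 1) \<le> ?C * \<bar>t - s\<bar> powr (\<alpha> - 1)"
        using h(1)[OF u] by (intro mult_right_mono) auto
      then show ?thesis using Op_hoelder[OF Mu M(1) that] ev_T that by simp
    qed
    ultimately show ?thesis unfolding hoelder_ball_def
      by (intro CollectI conjI ballI norm_C01_le)
  qed
  then show thesis using M(1) Gamma_pos(1) by (intro that[of ?C]) auto
qed

text \<open>
  The superposition operator \<open>u \<mapsto> f(\<cdot>, u(\<cdot>))\<close> is continuous in the supremum norm: near \<open>u\<close> all values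
  stay in a compact box, on which \<open>f\<close> is uniformly continuous.
\<close>

lemma f_ev_uniform:
  assumes "0 < e"
  shows "\<exists>d>0. \<forall>v s. dist v u < d \<longrightarrow> s \<in> {0..1} \<longrightarrow> \<bar>f s (ev v s) - f s (ev u s)\<bar> < e"
proof -
  let ?R = "norm u + 1"
  have "uniformly_continuous_on ({0..1} \<times> {-?R..?R}) (\<lambda>(t, x). f t x)"
    by (intro compact_uniformly_continuous f_cont_box compact_Times) auto
  from this[unfolded uniformly_continuous_on_def, rule_format, OF assms]
  obtain d where d: "0 < d" "\<And>z z'. z \<in> {0..1} \<times> {-?R..?R} \<Longrightarrow> z' \<in> {0..1} \<times> {-?R..?R} \<Longrightarrow>
      dist z' z < d \<Longrightarrow> dist (case z' of (t, x) \<Rightarrow> f t x) (case z of (t, x) \<Rightarrow> f t x) < e"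
    by blast
  show ?thesis
  proof (intro exI[of _ "min d 1"] conjI allI impI)
    fix v s assume v: "dist v u < min d 1" and s: "s \<in> {0..1::real}"
    have "norm v \<le> ?R" using v norm_triangle_ineq2[of v u] by (simp add: dist_norm)
    moreover have "dist (ev v s) (ev u s) < d"
      using abs_ev_le_norm[of "v - u" s] v by (simp add: ev_diff dist_norm)
    ultimately show "\<bar>f s (ev v s) - f s (ev u s)\<bar> < e"
      using d(2)[of "(s, ev u s)" "(s, ev v s)"] ev_in[of v ?R s] ev_in[of u ?R s] s
      by (simp add: dist_Pair_Pair dist_real_def)
  qed (use d in simp)
qed

lemma continuous_on_T: "continuous_on S T"
proof (rule continuous_onI)
  fix u and e :: real assume e: "0 < e"
  \<comment> \<open>An error of \<open>q\<close> in \<open>H1\<close>, \<open>H2\<close> and \<open>f\<close> is amplified by at most \<open>\<gamma> 0\<close>, \<open>1\<close> and \<open>Kmax\<close>.\<close>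
  define q where "q = e / (\<gamma> 0 + 1 + Kmax)"
  have den: "0 < \<gamma> 0 + 1 + Kmax" using gam_0_pos Kmax_pos by simp
  then have q: "0 < q" using e by (simp add: q_def)
  have "continuous_on UNIV H1" "continuous_on UNIV H2" using H1(1) H2(1) by (auto simp: compact_map_def)
  note cont = this[unfolded continuous_on_iff, rule_format, OF UNIV_I q, unfolded dist_real_def]
  obtain d1 d2 where d1: "0 < d1" "\<And>v. dist v u < d1 \<Longrightarrow> \<bar>H1 v - H1 u\<bar> < q"
    and d2: "0 < d2" "\<And>v. dist v u < d2 \<Longrightarrow> \<bar>H2 v - H2 u\<bar> < q"
    using cont[of u] by auto
  obtain d3 where d3: "0 < d3"
    "\<And>v s. dist v u < d3 \<Longrightarrow> s \<in> {0..1} \<Longrightarrow> \<bar>f s (ev v s) - f s (ev u s)\<bar> < q"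
    using f_ev_uniform[OF q, of u] by blast
  have "dist (T v) (T u) \<le> e" if v: "dist v u < min d1 (min d2 d3)" for v
    unfolding dist_norm
  proof (rule norm_C01_le)
    fix t :: real assume t: "t \<in> {0..1}"
    have "\<bar>(H1 v - H1 u) * \<gamma> t\<bar> \<le> q * \<gamma> 0"
      unfolding abs_mult using d1(2)[of v] v q gam_nonneg[of t] gam_antimono[of 0 t] t
      by (intro mult_mono) auto
    moreover have "\<bar>H2 v - H2 u\<bar> \<le> q" using d2(2)[of v] v by simp
    moreover have "\<bar>integral {0..1} (\<lambda>s. K t s * f s (ev v s) - K t s * f s (ev u s))\<bar> \<le> Kmax * q"
    proof (intro abs_integral_le integrable_diff integrable_kern_f)
      fix s :: real assume s: "s \<in> {0..1}"
      have "\<bar>K t s\<bar> * \<bar>f s (ev v s) - f s (ev u s)\<bar> \<le> Kmax * q"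
        using abs_kern_le[OF t, of s] d3(2)[of v s] v s Kmax_pos by (intro mult_mono) auto
      then show "\<bar>K t s * f s (ev v s) - K t s * f s (ev u s)\<bar> \<le> Kmax * q"
        by (simp flip: abs_mult right_diff_distrib)
    qed
    moreover have "Op v t - Op u t = (H1 v - H1 u) * \<gamma> t + (H2 v - H2 u)
        + integral {0..1} (\<lambda>s. K t s * f s (ev v s) - K t s * f s (ev u s))"
      unfolding bvp_op_def integral_diff[OF integrable_kern_f integrable_kern_f]
      by (simp add: right_diff_distrib left_diff_distrib)
    ultimately have "\<bar>Op v t - Op u t\<bar> \<le> q * \<gamma> 0 + q + Kmax * q" by linarith
    also have "\<dots> = q * (\<gamma> 0 + 1 + Kmax)" by (simp add: algebra_simps)
    also have "\<dots> = e" unfolding q_def using den by simp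
    finally show "\<bar>ev (T v - T u) t\<bar> \<le> e" using ev_T[OF t] by (simp add: ev_diff)
  qed
  then show "\<exists>d>0. \<forall>v\<in>S. dist v u < d \<longrightarrow> dist (T v) (T u) \<le> e"
    using d1(1) d2(1) d3(1) by (intro exI[of _ "min d1 (min d2 d3)"]) auto
qed

text \<open>
  The integrand is nonnegative, so the part of the integral over \<open>[b,1]\<close>, where \<open>\<delta>\<close> gives no
  information, may be dropped.
\<close>

lemma Op_0_ge:
  assumes "continuous_on {0..b} \<delta>" "\<And>s. s \<in> {0..b} \<Longrightarrow> \<delta> s \<le> f s (ev u s)"
    and "\<eta>1 \<le> H1 u" "\<eta>2 \<le> H2 u"
  shows "\<gamma> 0 * \<eta>1 + \<eta>2 + integral {0..b} (\<lambda>s. K 0 s * \<delta> s) \<le> Op u 0"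
proof -
  have sub: "{0..b} \<subseteq> {0..1}" using b by auto
  have int: "(\<lambda>s. K 0 s * f s (ev u s)) integrable_on {0..b}"
    using integrable_kern_f sub by (rule integrable_on_subinterval)
  have "integral {0..b} (\<lambda>s. K 0 s * \<delta> s) \<le> integral {0..b} (\<lambda>s. K 0 s * f s (ev u s))"
  proof (rule integral_le[OF _ int])
    show "(\<lambda>s. K 0 s * \<delta> s) integrable_on {0..b}"
      by (intro integrable_continuous_interval continuous_intros continuous_on_kern assms)
    show "K 0 s * \<delta> s \<le> K 0 s * f s (ev u s)" if "s \<in> {0..b}" for s
      using assms(2)[OF that] kern_nonneg[of 0 s] that by (intro mult_left_mono) auto
  qed
  also have "\<dots> \<le> integral {0..1} (\<lambda>s. K 0 s * f s (ev u s))"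
    using kern_nonneg[of 0] f_nonneg
    by (intro integral_subset_le[OF sub int integrable_kern_f]) (auto intro!: mult_nonneg_nonneg)
  finally have "integral {0..b} (\<lambda>s. K 0 s * \<delta> s) \<le> integral {0..1} (\<lambda>s. K 0 s * f s (ev u s))" .
  moreover have "\<gamma> 0 * \<eta>1 \<le> H1 u * \<gamma> 0"
    using assms(3) gam_0_pos by (simp add: mult.commute mult_left_mono)
  ultimately show ?thesis using assms(4) unfolding bvp_op_def by linarith
qed

end

theorem theorem3p3:
  fixes \<alpha> \<beta> \<eta> b \<rho> \<eta>1 \<eta>2 :: real
    and f :: "real \<Rightarrow> real \<Rightarrow> real"
    and H1 H2 :: "C01 \<Rightarrow> real"
    and \<delta> :: "real \<Rightarrow> real"
  assumes "1 < \<alpha>" "\<alpha> \<le> 2"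
    and "0 < \<eta>" "\<eta> < 1"
    and "0 < \<beta>"
    and "continuous_on ({0..1} \<times> UNIV) (\<lambda>(t, x). f t x)"
    and "\<forall>t\<in>{0..1}. \<forall>x. 0 \<le> f t x"
    and "compact_map H1" "\<forall>u. 0 \<le> H1 u"
    and "compact_map H2" "\<forall>u. 0 \<le> H2 u"
    and "\<beta> = max (beta_K \<alpha> \<eta>) (beta_gam \<alpha> \<eta>)"
    and "\<eta> \<le> b" "b < 1"
    and "0 < \<rho>"
    and "continuous_on {0..b} \<delta>" "\<forall>t\<in>{0..b}. 0 \<le> \<delta> t"
    and "\<forall>t\<in>{0..b}. \<forall>x\<in>{sigma2 \<alpha> \<beta> \<eta> b * \<rho>..\<rho>}. \<delta> t \<le> f t x"
    and "0 \<le> \<eta>1" "0 \<le> \<eta>2"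
    and "\<forall>u \<in> order_cone b (sigma2 \<alpha> \<beta> \<eta> b) \<inter> sphere 0 \<rho>. \<eta>1 \<le> H1 u \<and> \<eta>2 \<le> H2 u"
    and "gam \<alpha> \<beta> \<eta> 0 * \<eta>1 + \<eta>2 + integral {0..b} (\<lambda>s. kern \<alpha> \<beta> \<eta> 0 s * \<delta> s) > 0"
  shows "\<exists>lam>0. \<exists>u \<in> order_cone b (sigma2 \<alpha> \<beta> \<eta> b) \<inter> sphere 0 \<rho>.
      mild_solution \<alpha> \<beta> \<eta> f H1 H2 lam u
      \<and> (\<forall>t\<in>{0..1}. 0 \<le> ev u t)
      \<and> (\<forall>t\<in>{0..b}. sigma2 \<alpha> \<beta> \<eta> b * \<rho> \<le> ev u t \<and> ev u t \<le> \<rho>)"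
proof -
  interpret caputo_bvp_data \<alpha> \<beta> \<eta> b f H1 H2
    using assms(1-14) by unfold_locales auto
  define P where "P = order_cone b \<sigma>"
  define m where "m = \<gamma> 0 * \<eta>1 + \<eta>2 + integral {0..b} (\<lambda>s. K 0 s * \<delta> s)"
  have b01: "0 \<le> b" "b \<le> 1" using b \<eta> by auto
  note P_iff = order_cone_iff[OF b01, of _ \<sigma>, folded P_def]
  have on_b: "\<sigma> * \<rho> \<le> ev u t \<and> ev u t \<le> \<rho>" if "u \<in> P \<inter> sphere 0 \<rho>" "t \<in> {0..b}" for u t
    using that abs_ev_le_norm[of u t] by (auto simp: P_iff)
  have one: "const_bcontfun 1 \<in> P"
  proof -
    have "norm (const_bcontfun 1 :: C01) \<le> 1" by (intro norm_C01_le) (simp add: ev_one)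
    then have "\<sigma> * norm (const_bcontfun 1 :: C01) \<le> 1 * 1"
      using sigma2_bounds(1,2) by (intro mult_mono) auto
    then show ?thesis by (simp add: P_iff ev_one)
  qed
  have lower: "m \<le> norm (T u)" if u: "u \<in> P \<inter> sphere 0 \<rho>" for u
  proof -
    have "m \<le> Op u 0"
      unfolding m_def using assms(16,18,21) on_b[OF u] u
      by (intro Op_0_ge) (auto simp: P_def)
    also have "\<dots> \<le> norm (T u)" using ev_T[of 0 u] abs_ev_le_norm[of "T u" 0] by simp
    finally show ?thesis .
  qed
  obtain M C where C: "0 \<le> C" and range: "T ` cball 0 \<rho> \<subseteq> hoelder_ball (\<alpha> - 1) M C"
    by (rule T_into_hoelder_ball)
  obtain l u where l: "0 < l" and u: "u \<in> P \<inter> sphere 0 \<rho>" and eq: "u = l *\<^sub>R T u"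
  proof (rule birkhoff_kellogg_cone[of P "const_bcontfun 1" \<rho> T "hoelder_ball (\<alpha> - 1) M C" m])
    show "convex P" unfolding P_def using b01 sigma2_bounds(1) by (rule convex_order_cone)
    show "closed P" unfolding P_def using b01 by (rule closed_order_cone)
    show "c *\<^sub>R x \<in> P" if "0 \<le> c" "x \<in> P" for c x
      using order_cone_scaleR[OF b01] that by (simp add: P_def)
    show "norm (x + c *\<^sub>R const_bcontfun 1) = norm x + c" if "0 \<le> c" "x \<in> P" for c x
      using that by (intro norm_add_const) (auto simp: P_iff)
    show "compact (hoelder_ball (\<alpha> - 1) M C)" using \<alpha> C by (intro compact_hoelder_ball) auto
    show "T \<in> P \<inter> sphere 0 \<rho> \<rightarrow> P \<inter> hoelder_ball (\<alpha> - 1) M C"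
      using range T_in_cone by (auto simp: P_def)
    show "0 < m" using assms(22) by (simp add: m_def)
  qed (use one assms(15) lower continuous_on_T in auto)
  have "ev u t = l * Op u t" if "t \<in> {0..1}" for t
  proof -
    have "ev u t = ev (l *\<^sub>R T u) t" by (simp flip: eq)
    then show ?thesis using ev_T[OF that] by (simp add: ev_scaleR)
  qed
  then have "mild_solution \<alpha> \<beta> \<eta> f H1 H2 l u" by (simp add: mild_solution_def)
  moreover have "\<forall>t\<in>{0..1}. 0 \<le> ev u t" using u by (simp add: P_iff)
  ultimately show ?thesis using l u on_b[OF u] unfolding P_def by blast
qed

end
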